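(* Let $n\ge 8$ be an integer and let $W_n=C_{n-1}\vee K_1$ be the wheel graph on $n$ vertices. Then the visibility polynomial of $W_n$ is $$\mathcal{V}(W_n)=(1+x)^{n-1}+x+(n-1)x^2+2(n-1)x^3 .$$
   Context: Graphs are finite, simple, undirected and connected. For $X\subseteq V(G)$, two vertices $u,v\in V(G)$ are $X$-visible if there is a shortest $(u,v)$-path $P$ in $G$ with $V(P)\cap X\subseteq\{u,v\}$. A set $X\subseteq V(G)$ is a mutual-visibility set of $G$ if every pair of vertices of $X$ is $X$-visible (in particular the empty set and singletons are mutual-visibility sets). The visibility polynomial of $G$ is $\mathcal{V}(G)=\sum_{i\ge 0} r_i x^i$, where $r_i$ is the number of mutual-visibility sets of $G$ of cardinality $i$ (so $r_0=1$). $G\vee H$ denotes the join of two graphs. The wheel graph $W_n=C_{n-1}\vee K_1$ ($n\ge 4$) has $n$ vertices: the hub $h$ (the vertex of $K_1$), adjacent to every vertex of the cycle $C_{n-1}$ (the rim). *)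

theory Defs
  imports
    "Graph_Theory.Graph_Theory"
    "HOL-Computational_Algebra.Polynomial"
begin

text \<open>
  A simple undirected graph is a loop-free symmetric pair digraph (locale \<^locale>\<open>pair_graph\<close>);
  the edge between \<open>u\<close> and \<open>v\<close> is the pair of arcs \<open>(u, v)\<close> and \<open>(v, u)\<close>.
\<close>

definition shortest_vpath :: "'a pair_pre_digraph \<Rightarrow> 'a \<Rightarrow> 'a vwalk \<Rightarrow> 'a \<Rightarrow> bool" where
  "shortest_vpath G u p v \<longleftrightarrow>
     vpath p (with_proj G) \<and> hd p = u \<and> last p = v \<and>
     (\<forall>q. vpath q (with_proj G) \<and> hd q = u \<and> last q = v \<longrightarrow> vwalk_length p \<le> vwalk_length q)"

definition visible :: "'a pair_pre_digraph \<Rightarrow> 'a set \<Rightarrow> 'a \<Rightarrow> 'a \<Rightarrow> bool" where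
  "visible G X u v \<longleftrightarrow> (\<exists>p. shortest_vpath G u p v \<and> set p \<inter> X \<subseteq> {u, v})"

text \<open>
  The case \<open>u = v\<close> below imposes nothing, by the path \<open>[u]\<close>.
\<close>

definition mutual_visibility_set :: "'a pair_pre_digraph \<Rightarrow> 'a set \<Rightarrow> bool" where
  "mutual_visibility_set G X \<longleftrightarrow>
     X \<subseteq> pverts G \<and> (\<forall>u\<in>X. \<forall>v\<in>X. visible G X u v)"

definition num_mutual_visibility_sets :: "'a pair_pre_digraph \<Rightarrow> nat \<Rightarrow> nat" where
  "num_mutual_visibility_sets G i = card {X. mutual_visibility_set G X \<and> card X = i}"

text \<open>
  For finite \<open>G\<close> no subset of the vertices has more than \<open>card (pverts G)\<close> elements, so
  the finite sum has all nonzero terms of the sum over all \<open>i\<close>.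
\<close>

definition visibility_poly :: "'a pair_pre_digraph \<Rightarrow> int poly" where
  "visibility_poly G =
     (\<Sum>i\<le>card (pverts G). monom (int (num_mutual_visibility_sets G i)) i)"

definition graph_join ::
  "'a pair_pre_digraph \<Rightarrow> 'b pair_pre_digraph \<Rightarrow> ('a + 'b) pair_pre_digraph" where
  "graph_join G H =
     \<lparr> pverts = pverts G <+> pverts H,
       parcs = map_prod Inl Inl ` parcs G \<union> map_prod Inr Inr ` parcs H \<union>
         (Inl ` pverts G) \<times> (Inr ` pverts H) \<union> (Inr ` pverts H) \<times> (Inl ` pverts G) \<rparr>"

text \<open>
  This is the cycle on \<open>m\<close> vertices only for \<open>m \<ge> 3\<close>; for \<open>m = 1\<close> it has a loop.
\<close>

definition cycle_graph :: "nat \<Rightarrow> nat pair_pre_digraph" where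
  "cycle_graph m =
     \<lparr> pverts = {..<m},
       parcs = {(i, j). i < m \<and> j < m \<and> (j = Suc i mod m \<or> i = Suc j mod m)} \<rparr>"

definition complete_graph :: "nat \<Rightarrow> nat pair_pre_digraph" where
  "complete_graph k =
     \<lparr> pverts = {..<k}, parcs = {(i, j). i < k \<and> j < k \<and> i \<noteq> j} \<rparr>"

definition wheel_graph :: "nat \<Rightarrow> (nat + nat) pair_pre_digraph" where
  "wheel_graph n = graph_join (cycle_graph (n - 1)) (complete_graph 1)"

lemma pair_graph_graph_join:
  assumes "pair_graph G" "pair_graph H"
  shows "pair_graph (graph_join G H)"
proof -
  interpret G: pair_graph G by fact
  interpret H: pair_graph H by fact
  have sG: "(v, u) \<in> parcs G" if "(u, v) \<in> parcs G" for u v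
    using that G.pair_sym_arcs by (auto simp: symmetric_def dest: symD)
  have sH: "(v, u) \<in> parcs H" if "(u, v) \<in> parcs H" for u v
    using that H.pair_sym_arcs by (auto simp: symmetric_def dest: symD)
  show ?thesis
  proof
    show "symmetric (with_proj (graph_join G H))"
      by (force simp: symmetric_def graph_join_def intro!: symI dest: sG sH)
  qed (use G.pair_finite_verts G.pair_finite_arcs H.pair_finite_verts H.pair_finite_arcs
         in \<open>auto simp: graph_join_def map_prod_def
               dest: G.arc_fst_in_verts G.arc_snd_in_verts G.pair_no_loops
                     H.arc_fst_in_verts H.arc_snd_in_verts H.pair_no_loops\<close>)
qed

lemma pair_graph_cycle_graph:
  assumes "m \<ge> 3"
  shows "pair_graph (cycle_graph m)"
proof
  show "finite (parcs (cycle_graph m))"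
    by (rule finite_subset[of _ "{..<m} \<times> {..<m}"]) (auto simp: cycle_graph_def)
  show "symmetric (with_proj (cycle_graph m))"
    by (auto simp: symmetric_def cycle_graph_def intro!: symI)
qed (use assms in \<open>auto simp: cycle_graph_def mod_Suc split: if_splits\<close>)

lemma complete_digraph_complete_graph: "complete_digraph k (with_proj (complete_graph k))"
  unfolding complete_digraph_pair_def by (auto simp: complete_graph_def)

lemma pair_graph_wheel_graph:
  assumes "n \<ge> 4"
  shows "pair_graph (wheel_graph n)"
  unfolding wheel_graph_def
  using assms complete_digraph_complete_graph[of 1]
  by (intro pair_graph_graph_join pair_graph_cycle_graph)
     (auto intro: pair_graphI_complete)

lemma card_pverts_wheel_graph:
  assumes "n \<ge> 1"
  shows "card (pverts (wheel_graph n)) = n"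
  using assms
  by (simp add: wheel_graph_def graph_join_def cycle_graph_def complete_graph_def card_Plus)

lemma connected_wheel_graph:
  assumes "n \<ge> 4"
  shows "connected (with_proj (wheel_graph n))"
proof -
  interpret pair_graph "wheel_graph n" by (rule pair_graph_wheel_graph[OF assms])
  let ?h = "Inr 0 :: nat + nat"
  have h: "?h \<in> pverts (wheel_graph n)"
    by (auto simp: wheel_graph_def graph_join_def complete_graph_def)
  have hub: "v = ?h \<or> (v, ?h) \<in> parcs (wheel_graph n) \<and> (?h, v) \<in> parcs (wheel_graph n)"
    if "v \<in> pverts (wheel_graph n)" for v
    using that by (auto simp: wheel_graph_def graph_join_def complete_graph_def)
  have "u \<rightarrow>\<^sup>*\<^bsub>with_proj (wheel_graph n)\<^esub> v"
    if "u \<in> pverts (wheel_graph n)" "v \<in> pverts (wheel_graph n)" for u v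
  proof -
    have "u \<rightarrow>\<^sup>*\<^bsub>with_proj (wheel_graph n)\<^esub> ?h" "?h \<rightarrow>\<^sup>*\<^bsub>with_proj (wheel_graph n)\<^esub> v"
      using hub[OF that(1)] hub[OF that(2)] h by auto
    then show ?thesis by (rule reachable_trans)
  qed
  then show ?thesis
    using h by (intro connectedI) (auto intro: reachable_mk_symmetricI)
qed

end

theory Submission
  imports Defs
begin

text \<open>
  Two non-adjacent vertices of the wheel have the hub as a common neighbour, so they are visible with
  respect to \<open>X\<close> iff some common neighbour lies outside \<open>X\<close>. Hence every set of rim vertices
  is a mutual-visibility set. A set consisting of the hub and a set \<open>S\<close> of rim vertices is one iff
  any two elements of \<open>S\<close> are at cyclic distance one, or at cyclic distance two with their midpoint
  outside \<open>S\<close>. Orient each such pair in the direction of the rim. On three elements of \<open>S\<close> a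
  cyclic orientation would go round the rim in at most six steps, and a transitive one would have
  the middle element as midpoint of the other two; so for a rim of at least seven vertices \<open>S\<close> has
  at most two elements.
\<close>

section \<open>Visibility at distance at most two\<close>

lemma (in pair_graph) visible_refl:
  assumes "u \<in> pverts G"
  shows "visible G X u u"
  unfolding visible_def shortest_vpath_def
  using assms by (intro exI[of _ "[u]"]) (auto simp: vpath_def vwalk_def)

lemma length_vpath_ge_2:
  assumes "vpath q G" "hd q \<noteq> last q"
  shows "length q \<ge> 2"
proof (cases q)
  case Nil
  then show ?thesis using assms by (simp add: vpath_def vwalk_def)
next
  case (Cons a r)
  then show ?thesis using assms by (cases r) auto
qed

lemma (in pair_graph) visible_adj:
  assumes "(u, v) \<in> parcs G"
  shows "visible G X u v"
proof -
  have "u \<noteq> v" using pair_no_loops[OF assms] by simp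
  moreover have "vpath [u, v] (with_proj G)"
    using assms \<open>u \<noteq> v\<close> arc_fst_in_verts arc_snd_in_verts
    by (fastforce simp: vpath_def vwalk_def)
  moreover have "vwalk_length q \<ge> 1" if "vpath q (with_proj G)" "hd q = u" "last q = v" for q
    using length_vpath_ge_2[OF that(1)] that \<open>u \<noteq> v\<close> by auto
  ultimately show ?thesis
    unfolding visible_def shortest_vpath_def by (intro exI[of _ "[u, v]"]) simp
qed

lemma (in pair_graph) length_vpath_ge_3:
  assumes "vpath q (with_proj G)" "hd q \<noteq> last q" "(hd q, last q) \<notin> parcs G"
  shows "length q \<ge> 3"
proof (rule ccontr)
  assume "\<not> length q \<ge> 3"
  then have "length q = 2" using length_vpath_ge_2[OF assms(1,2)] by simp
  then obtain a b where "q = [a, b]" by (auto simp: length_Suc_conv numeral_2_eq_2)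
  then show False using assms by (auto simp: vpath_def vwalk_def)
qed

text \<open>The path through \<open>w0\<close> has length two and nothing shorter exists, so the
  shortest paths are exactly the \<open>[u, w, v]\<close>, whose only inner vertex is
  \<open>w\<close>.\<close>

lemma (in pair_graph) visible_nonadj_iff:
  assumes "u \<noteq> v" "(u, v) \<notin> parcs G" "(u, w0) \<in> parcs G" "(w0, v) \<in> parcs G"
  shows "visible G X u v \<longleftrightarrow> (\<exists>w. (u, w) \<in> parcs G \<and> (w, v) \<in> parcs G \<and> w \<notin> X)"
proof -
  have path: "vpath [u, w, v] (with_proj G)" if "(u, w) \<in> parcs G" "(w, v) \<in> parcs G" for w
    using that assms(1) pair_no_loops[OF that(1)] pair_no_loops[OF that(2)]
      arc_fst_in_verts[OF that(1)] arc_fst_in_verts[OF that(2)] arc_snd_in_verts[OF that(2)]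
    by (auto simp: vpath_def vwalk_def)
  have long: "length q \<ge> 3" if "vpath q (with_proj G)" "hd q = u" "last q = v" for q
    using length_vpath_ge_3[OF that(1)] that assms by auto
  show ?thesis
  proof
    assume "visible G X u v"
    then obtain p where p: "shortest_vpath G u p v" "set p \<inter> X \<subseteq> {u, v}"
      by (auto simp: visible_def)
    then have pv: "vpath p (with_proj G)" "hd p = u" "last p = v"
      by (auto simp: shortest_vpath_def)
    have "vwalk_length p \<le> vwalk_length [u, w0, v]"
      using p(1) path[OF assms(3,4)] unfolding shortest_vpath_def
      by (metis last.simps list.distinct(1) list.sel(1))
    then have "length p = 3" using long[OF pv] by simp
    then obtain w where "p = [u, w, v]"
      using pv(2,3) by (auto simp: length_Suc_conv numeral_3_eq_3)
    then show "\<exists>w. (u, w) \<in> parcs G \<and> (w, v) \<in> parcs G \<and> w \<notin> X"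
      using pv(1) p(2) by (auto simp: vpath_def vwalk_def)
  next
    assume "\<exists>w. (u, w) \<in> parcs G \<and> (w, v) \<in> parcs G \<and> w \<notin> X"
    then obtain w where w: "(u, w) \<in> parcs G" "(w, v) \<in> parcs G" "w \<notin> X" by blast
    show "visible G X u v"
      unfolding visible_def shortest_vpath_def
    proof (intro exI[of _ "[u, w, v]"] conjI allI impI)
      fix q assume "vpath q (with_proj G) \<and> hd q = u \<and> last q = v"
      then show "vwalk_length [u, w, v] \<le> vwalk_length q" using long[of q] by simp
    qed (use path[OF w(1,2)] w(3) in auto)
  qed
qed

text \<open>A vertex \<open>h\<close> adjacent to all others is a common neighbour of any two
  distinct non-adjacent vertices, neither of which can be \<open>h\<close>. Visibility thus becomes
  a condition on arcs alone.\<close>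

lemma (in pair_graph) visible_iff_hub:
  assumes "u \<in> pverts G" "v \<in> pverts G"
    and hub: "\<And>x. x \<in> pverts G \<Longrightarrow> x \<noteq> h \<Longrightarrow> (x, h) \<in> parcs G \<and> (h, x) \<in> parcs G"
  shows "visible G X u v \<longleftrightarrow>
    u = v \<or> (u, v) \<in> parcs G \<or> (\<exists>w. (u, w) \<in> parcs G \<and> (w, v) \<in> parcs G \<and> w \<notin> X)"
proof (cases "u = v \<or> (u, v) \<in> parcs G")
  case True
  then show ?thesis using visible_refl visible_adj assms(1) by auto
next
  case False
  then have "u \<noteq> h" "v \<noteq> h" using hub assms(1,2) by metis+
  then show ?thesis using visible_nonadj_iff[of u v h X] False hub assms(1,2) by auto
qed

section \<open>The polynomial as a sum over mutual-visibility sets\<close>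

text \<open>Grouping the sets by size replaces the coefficients by one sum in the indeterminate
  \<open>[:0, 1:]\<close>, so that a classification of the sets yields the polynomial
  directly.\<close>

lemma visibility_poly_eq_sum:
  assumes "finite (pverts G)"
  shows "visibility_poly G = (\<Sum>X | mutual_visibility_set G X. [:0, 1:] ^ card X)"
proof -
  let ?M = "{X. mutual_visibility_set G X}"
  have sub: "?M \<subseteq> Pow (pverts G)" by (auto simp: mutual_visibility_set_def)
  then have fin: "finite ?M" using assms by (meson finite_Pow_iff finite_subset)
  have "(\<Sum>X\<in>?M. [:0, 1:] ^ card X)
      = (\<Sum>i\<le>card (pverts G). \<Sum>X | X \<in> ?M \<and> card X = i. [:0, 1:: int:] ^ card X)"
    using sub by (intro sum.group[symmetric] fin) (auto intro!: card_mono assms)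
  also have "\<dots> = visibility_poly G"
    unfolding visibility_poly_def num_mutual_visibility_sets_def
    by (intro sum.cong) (auto simp: monom_altdef of_nat_poly)
  finally show ?thesis by simp
qed

text \<open>In the expanded product of \<open>x + 1\<close> over \<open>A\<close>, a subset records
  the factors from which \<open>x\<close> is taken.\<close>

lemma sum_Pow_power_card:
  fixes x :: "'b::comm_semiring_1"
  assumes "finite A"
  shows "(\<Sum>X\<in>Pow A. x ^ card X) = (1 + x) ^ card A"
  using prod_add[OF assms, of "\<lambda>_. x" "\<lambda>_. 1"] by (simp add: add.commute)

section \<open>Sets of rim vertices visible around the hub\<close>

definition csuc :: "nat \<Rightarrow> nat \<Rightarrow> nat" where
  "csuc m i = Suc i mod m"

lemma csuc_less: "i < m \<Longrightarrow> csuc m i < m"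
  by (simp add: csuc_def)

lemma csuc_eq_if: "i < m \<Longrightarrow> csuc m i = (if Suc i = m then 0 else Suc i)"
  by (simp add: csuc_def)

lemma csuc_inj: "i < m \<Longrightarrow> j < m \<Longrightarrow> csuc m i = csuc m j \<longleftrightarrow> i = j"
  by (auto simp: csuc_eq_if split: if_splits)

lemma csuc_csuc_eq_if: "i < m \<Longrightarrow> 2 \<le> m \<Longrightarrow>
    csuc m (csuc m i) = (if i + 2 < m then i + 2 else i + 2 - m)"
  by (simp add: csuc_def mod_Suc)

text \<open>Six is the most that three moves of one or two steps can advance; a rim of seven
  vertices is just long enough to keep them from closing up.\<close>

lemma csuc_neq:
  assumes "i < m" "7 \<le> m"
  defines "s \<equiv> csuc m"
  shows "s i \<noteq> i" "s (s i) \<noteq> i" "s (s (s i)) \<noteq> i" "s (s (s (s i))) \<noteq> i"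
    "s (s (s (s (s i)))) \<noteq> i" "s (s (s (s (s (s i))))) \<noteq> i"
  using assms(1,2) by (simp_all add: s_def csuc_csuc_eq_if csuc_eq_if)

definition cyc_adj :: "nat \<Rightarrow> nat \<Rightarrow> nat \<Rightarrow> bool" where
  "cyc_adj m i j \<longleftrightarrow> i < m \<and> j < m \<and> (j = csuc m i \<or> i = csuc m j)"

text \<open>The visibility condition on the rim part \<open>S\<close> of a set containing the hub:
  the hub is blocked as a midpoint, so a free common neighbour must lie on the rim.\<close>

definition rim_visible :: "nat \<Rightarrow> nat set \<Rightarrow> bool" where
  "rim_visible m S \<longleftrightarrow> S \<subseteq> {..<m} \<and> (\<forall>i\<in>S. \<forall>j\<in>S. i = j \<or> cyc_adj m i j \<or>
     (\<exists>k. cyc_adj m i k \<and> cyc_adj m k j \<and> k \<notin> S))"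

definition follows :: "nat \<Rightarrow> nat set \<Rightarrow> nat \<Rightarrow> nat \<Rightarrow> bool" where
  "follows m S i j \<longleftrightarrow> j = csuc m i \<or> j = csuc m (csuc m i) \<and> csuc m i \<notin> S"

text \<open>The two steps of a rim path from \<open>i\<close> over \<open>k\<close> to
  \<open>j\<close> go the same way: opposite directions would force \<open>i = j\<close>, either at
  once or by injectivity of \<open>csuc\<close>.\<close>

lemma rim_visible_follows:
  assumes "rim_visible m S" "i \<in> S" "j \<in> S" "i \<noteq> j"
  shows "follows m S i j \<or> follows m S j i"
  using assms csuc_inj unfolding rim_visible_def cyc_adj_def follows_def by blast

text \<open>Three moves advance by three to six steps, too few to go round the rim.\<close>

lemma follows_acyclic:
  assumes "7 \<le> m" "i < m" "follows m S i j" "follows m S j k" "follows m S k i"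
  shows False
proof -
  have "j \<in> {csuc m i, csuc m (csuc m i)}" "k \<in> {csuc m j, csuc m (csuc m j)}"
    "i \<in> {csuc m k, csuc m (csuc m k)}"
    using assms(3-5) by (auto simp: follows_def)
  then show False using csuc_neq[OF assms(2,1)] by auto
qed

text \<open>Via \<open>j\<close> one advances two to four steps from \<open>i\<close> to
  \<open>k\<close>, directly at most two. These agree only if \<open>j\<close> is the midpoint,
  which \<open>follows\<close> requires to lie outside \<open>S\<close>.\<close>

lemma follows_intransitive:
  assumes "7 \<le> m" "i < m" "j \<in> S" "follows m S i j" "follows m S j k"
  shows "\<not> follows m S i k"
proof
  assume "follows m S i k"
  note neq = csuc_neq[OF _ assms(1)]
  have less: "csuc m i < m" "csuc m (csuc m i) < m" using assms(2) by (simp_all add: csuc_less)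
  have k: "k = csuc m j \<or> k = csuc m (csuc m j)" using assms(5) by (auto simp: follows_def)
  show False
  proof (cases "j = csuc m i")
    case True
    then have "k = j" using assms(3) \<open>follows m S i k\<close> by (auto simp: follows_def)
    then show False using k neq(1,2)[OF less(1)] True by auto
  next
    case False
    then have "j = csuc m (csuc m i)" using assms(4) by (auto simp: follows_def)
    then show False
      using k \<open>follows m S i k\<close> neq(2,3)[OF less(1)] neq(1,2)[OF less(2)] by (auto simp: follows_def)
  qed
qed

lemma rim_visible_iff:
  assumes "7 \<le> m"
  shows "rim_visible m S \<longleftrightarrow> S = {} \<or>
    (\<exists>i<m. S = {i} \<or> S = {i, csuc m i} \<or> S = {i, csuc m (csuc m i)})"
proof
  assume vis: "rim_visible m S"
  then have sub: "S \<subseteq> {..<m}" by (simp add: rim_visible_def)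
  have three: False if "i \<in> S" "j \<in> S" "k \<in> S" "i \<noteq> j" "i \<noteq> k" "j \<noteq> k" for i j k
  proof -
    have less: "x < m" if "x \<in> S" for x using sub that by auto
    have acyclic: "\<not> (follows m S x y \<and> follows m S y z \<and> follows m S z x)" if "x \<in> S" for x y z
      using follows_acyclic[OF assms less[OF that]] by blast
    have intrans: "\<not> (follows m S x y \<and> follows m S y z \<and> follows m S x z)"
      if "x \<in> S" "y \<in> S" for x y z
      using follows_intransitive[OF assms less[OF that(1)] that(2)] by blast
    have "follows m S i j \<or> follows m S j i" "follows m S i k \<or> follows m S k i"
      "follows m S j k \<or> follows m S k j"
      using rim_visible_follows[OF vis] that by metis+
    \<comment> \<open>Of the eight orientations of the three pairs, two are cyclic and six
      transitive; the instances supplied refute each of them.\<close>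
    then show False
      using acyclic[OF that(1), of j k] acyclic[OF that(1), of k j]
        intrans[OF that(1,2), of k] intrans[OF that(1,3), of j] intrans[OF that(2,1), of k]
        intrans[OF that(2,3), of i] intrans[OF that(3,1), of j] intrans[OF that(3,2), of i]
      by argo
  qed
  show "S = {} \<or> (\<exists>i<m. S = {i} \<or> S = {i, csuc m i} \<or> S = {i, csuc m (csuc m i)})"
  proof (cases "\<exists>i\<in>S. \<exists>j\<in>S. i \<noteq> j")
    case True
    then obtain i j where ij: "i \<in> S" "j \<in> S" "i \<noteq> j" by blast
    then have "S = {i, j}" using three by blast
    moreover have "follows m S i j \<or> follows m S j i" using rim_visible_follows[OF vis ij] .
    moreover have "i < m" "j < m" using ij sub by auto
    \<comment> \<open>The witness is whichever of the two elements the other one follows.\<close>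
    ultimately show ?thesis unfolding follows_def by (metis insert_commute)
  next
    case False
    then show ?thesis using sub by blast
  qed
next
  assume "S = {} \<or> (\<exists>i<m. S = {i} \<or> S = {i, csuc m i} \<or> S = {i, csuc m (csuc m i)})"
  then show "rim_visible m S"
  proof (elim disjE exE conjE)
    fix i assume i: "i < m" "S = {i, csuc m (csuc m i)}"
    \<comment> \<open>Only a pair two steps apart needs a free midpoint: \<open>csuc m i\<close>,
      distinct from both ends.\<close>
    have "cyc_adj m i (csuc m i)" "cyc_adj m (csuc m i) (csuc m (csuc m i))"
      "cyc_adj m (csuc m i) i" "cyc_adj m (csuc m (csuc m i)) (csuc m i)" "csuc m i \<notin> S"
      using i csuc_neq[OF i(1) assms] csuc_neq[OF csuc_less[OF i(1)] assms]
      by (auto simp: cyc_adj_def csuc_less)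
    then show ?thesis using i unfolding rim_visible_def by (auto simp: csuc_less)
  qed (auto simp: rim_visible_def cyc_adj_def csuc_less)
qed

text \<open>The exponent also counts the hub. The empty set gives \<open>x\<close>, the singletons
  the square term, and the pairs one and two steps apart contribute \<open>m\<close> cubes
  each.\<close>

lemma sum_rim_visible:
  fixes x :: "'b::comm_semiring_1"
  assumes "7 \<le> m"
  shows "(\<Sum>S | rim_visible m S. x ^ Suc (card S)) = x + of_nat m * x ^ 2 + of_nat (2 * m) * x ^ 3"
proof -
  let ?R = "{..<m}" and ?s = "csuc m"
  let ?A = "(\<lambda>i. {i}) ` ?R" and ?B = "(\<lambda>i. {i, ?s i}) ` ?R" and ?C = "(\<lambda>i. {i, ?s (?s i)}) ` ?R"
  let ?f = "\<lambda>S. x ^ Suc (card S)"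
  \<comment> \<open>Matching two pairs crosswise would close a walk of two steps within
    \<open>?B\<close>, of four within \<open>?C\<close>, and of three between \<open>?B\<close> and
    \<open>?C\<close>. Hence each pair is counted once.\<close>
  have neq: "?s i \<noteq> i" "?s (?s i) \<noteq> i" "?s (?s (?s i)) \<noteq> i" "?s (?s (?s (?s i))) \<noteq> i" if "i < m" for i
    using csuc_neq[OF that assms] by auto
  have "{S. rim_visible m S} = {{}} \<union> ?A \<union> ?B \<union> ?C"
    by (auto simp: rim_visible_iff[OF assms])
  moreover have "{{}} \<inter> ?A = {}" "({{}} \<union> ?A) \<inter> ?B = {}"
    using neq by (auto simp: doubleton_eq_iff)
  moreover have "({{}} \<union> ?A \<union> ?B) \<inter> ?C = {}"
    using neq by (fastforce simp: doubleton_eq_iff csuc_inj csuc_less)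
  moreover have "sum ?f ?A = of_nat m * x ^ 2"
    by (subst sum.reindex) (auto simp: inj_on_def power2_eq_square)
  moreover have "sum ?f ?B = of_nat m * x ^ 3"
  proof -
    have "inj_on (\<lambda>i. {i, ?s i}) ?R"
      using neq by (auto simp: inj_on_def doubleton_eq_iff)
    moreover have "card {i, ?s i} = 2" if "i < m" for i
      using neq(1)[OF that] by (metis card_2_iff)
    ultimately show ?thesis by (simp add: sum.reindex eval_nat_numeral)
  qed
  moreover have "sum ?f ?C = of_nat m * x ^ 3"
  proof -
    have "inj_on (\<lambda>i. {i, ?s (?s i)}) ?R"
      using neq by (auto simp: inj_on_def doubleton_eq_iff)
    moreover have "card {i, ?s (?s i)} = 2" if "i < m" for i
      using neq(2)[OF that] by (metis card_2_iff)
    ultimately show ?thesis by (simp add: sum.reindex eval_nat_numeral)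
  qed
  ultimately show ?thesis
    by (simp add: sum.union_disjoint algebra_simps mult_2)
qed

section \<open>Mutual-visibility sets of the wheel\<close>

lemma pverts_wheel_graph: "pverts (wheel_graph n) = insert (Inr 0) (Inl ` {..<n - 1})"
  by (auto simp: wheel_graph_def graph_join_def cycle_graph_def complete_graph_def)

lemma parcs_wheel_graph [simp]:
  "(Inl i, Inl j) \<in> parcs (wheel_graph n) \<longleftrightarrow> cyc_adj (n - 1) i j"
  "(Inl i, Inr a) \<in> parcs (wheel_graph n) \<longleftrightarrow> i < n - 1 \<and> a = 0"
  "(Inr a, Inl i) \<in> parcs (wheel_graph n) \<longleftrightarrow> i < n - 1 \<and> a = 0"
  "(Inr a, Inr b) \<notin> parcs (wheel_graph n)"
  by (auto simp: wheel_graph_def graph_join_def cycle_graph_def complete_graph_def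
      cyc_adj_def csuc_def)

lemma visible_wheel_graph_iff:
  assumes "n \<ge> 4" "u \<in> pverts (wheel_graph n)" "v \<in> pverts (wheel_graph n)"
  shows "visible (wheel_graph n) X u v \<longleftrightarrow>
    u = v \<or> (u, v) \<in> parcs (wheel_graph n) \<or>
    (\<exists>w. (u, w) \<in> parcs (wheel_graph n) \<and> (w, v) \<in> parcs (wheel_graph n) \<and> w \<notin> X)"
proof -
  interpret pair_graph "wheel_graph n" by (rule pair_graph_wheel_graph[OF assms(1)])
  show ?thesis
    using assms(2,3) by (rule visible_iff_hub[where h = "Inr 0"]) (auto simp: pverts_wheel_graph)
qed

lemma mutual_visibility_rim:
  assumes "n \<ge> 4" "X \<subseteq> Inl ` {..<n - 1}"
  shows "mutual_visibility_set (wheel_graph n) X"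
proof -
  have X: "X \<subseteq> pverts (wheel_graph n)" using assms(2) by (auto simp: pverts_wheel_graph)
  have "visible (wheel_graph n) X u v" if "u \<in> X" "v \<in> X" for u v
  proof -
    have "(u, Inr 0) \<in> parcs (wheel_graph n)" "(Inr 0, v) \<in> parcs (wheel_graph n)" "Inr 0 \<notin> X"
      using that assms(2) by auto
    then show ?thesis using visible_wheel_graph_iff[OF assms(1)] that X by blast
  qed
  then show ?thesis using X by (simp add: mutual_visibility_set_def)
qed

text \<open>Pairs involving the hub are adjacent or equal and impose nothing, so only pairs of rim
  vertices matter.\<close>

lemma mutual_visibility_hub_iff:
  assumes "n \<ge> 4"
  shows "mutual_visibility_set (wheel_graph n) (insert (Inr 0) (Inl ` S)) \<longleftrightarrow>
    rim_visible (n - 1) S" (is "mutual_visibility_set _ ?X \<longleftrightarrow> _")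
proof (cases "S \<subseteq> {..<n - 1}")
  case True
  then have X: "?X \<subseteq> pverts (wheel_graph n)" by (auto simp: pverts_wheel_graph)
  have vis: "visible (wheel_graph n) ?X u v \<longleftrightarrow>
      u = v \<or> (u, v) \<in> parcs (wheel_graph n) \<or>
      (\<exists>w. (u, w) \<in> parcs (wheel_graph n) \<and> (w, v) \<in> parcs (wheel_graph n) \<and> w \<notin> ?X)"
    if "u \<in> ?X" "v \<in> ?X" for u v
    using visible_wheel_graph_iff[OF assms] that X by blast
  have hub: "visible (wheel_graph n) ?X u v" if "u \<in> ?X" "v \<in> ?X" "u = Inr 0 \<or> v = Inr 0" for u v
    using that True by (subst vis[OF that(1,2)]) auto
  have rim: "visible (wheel_graph n) ?X (Inl i) (Inl j) \<longleftrightarrow>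
      i = j \<or> cyc_adj (n - 1) i j \<or> (\<exists>k. cyc_adj (n - 1) i k \<and> cyc_adj (n - 1) k j \<and> k \<notin> S)"
    if "i \<in> S" "j \<in> S" for i j
  proof -
    have "(\<exists>w. (Inl i, w) \<in> parcs (wheel_graph n) \<and> (w, Inl j) \<in> parcs (wheel_graph n) \<and> w \<notin> ?X)
      \<longleftrightarrow> (\<exists>k. cyc_adj (n - 1) i k \<and> cyc_adj (n - 1) k j \<and> k \<notin> S)" (is "?l \<longleftrightarrow> ?r")
    proof
      assume ?l
      then obtain w where w: "(Inl i, w) \<in> parcs (wheel_graph n)"
        "(w, Inl j) \<in> parcs (wheel_graph n)" "w \<notin> ?X" by blast
      \<comment> \<open>The only candidate for \<open>w\<close> off the rim is \<open>Inr 0\<close>,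
        which belongs to \<open>?X\<close>.\<close>
      then show ?r by (cases w) auto
    next
      assume ?r
      then obtain k where "cyc_adj (n - 1) i k" "cyc_adj (n - 1) k j" "k \<notin> S" by blast
      then show ?l by (intro exI[of _ "Inl k"]) auto
    qed
    then show ?thesis using that by (subst vis) auto
  qed
  have "mutual_visibility_set (wheel_graph n) ?X \<longleftrightarrow>
      (\<forall>i\<in>S. \<forall>j\<in>S. visible (wheel_graph n) ?X (Inl i) (Inl j))"
    using X hub by (auto simp: mutual_visibility_set_def)
  then show ?thesis using True rim by (simp add: rim_visible_def)
next
  case False
  then show ?thesis by (auto simp: mutual_visibility_set_def pverts_wheel_graph rim_visible_def)
qed

lemma mutual_visibility_wheel_graph:
  assumes "n \<ge> 4"
  shows "{X. mutual_visibility_set (wheel_graph n) X} =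
    Pow (Inl ` {..<n - 1}) \<union> (\<lambda>S. insert (Inr 0) (Inl ` S)) ` {S. rim_visible (n - 1) S}"
proof (intro equalityI subsetI)
  fix X assume "X \<in> {X. mutual_visibility_set (wheel_graph n) X}"
  then have mv: "mutual_visibility_set (wheel_graph n) X" by simp
  then have X: "X \<subseteq> insert (Inr 0) (Inl ` {..<n - 1})"
    by (simp add: mutual_visibility_set_def pverts_wheel_graph)
  show "X \<in> Pow (Inl ` {..<n - 1}) \<union>
      (\<lambda>S. insert (Inr 0) (Inl ` S)) ` {S. rim_visible (n - 1) S}"
  proof (cases "Inr 0 \<in> X")
    case True
    define S where "S = Inl -` X"
    have S: "X = insert (Inr 0) (Inl ` S)" using True X by (auto simp: S_def)
    then have "rim_visible (n - 1) S" using mv mutual_visibility_hub_iff[OF assms] by simp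
    then show ?thesis using S by simp
  next
    case False
    then show ?thesis using X by auto
  qed
next
  fix X :: "(nat + nat) set" assume "X \<in> Pow (Inl ` {..<n - 1}) \<union>
      (\<lambda>S. insert (Inr 0) (Inl ` S)) ` {S. rim_visible (n - 1) S}"
  then show "X \<in> {X. mutual_visibility_set (wheel_graph n) X}"
  proof
    assume "X \<in> Pow (Inl ` {..<n - 1})"
    then show ?thesis using mutual_visibility_rim[OF assms] by simp
  next
    assume "X \<in> (\<lambda>S. insert (Inr 0) (Inl ` S)) ` {S. rim_visible (n - 1) S}"
    then show ?thesis using mutual_visibility_hub_iff[OF assms] by blast
  qed
qed

theorem theorem2:
  fixes n :: nat
  assumes "n \<ge> 8"
  shows "visibility_poly (wheel_graph n) =
    (1 + [:0, 1:]) ^ (n - 1) + [:0, 1:] + of_nat (n - 1) * [:0, 1:] ^ 2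
      + of_nat (2 * (n - 1)) * [:0, 1:] ^ 3"
proof -
  let ?m = "n - 1" and ?x = "[:0, 1:] :: int poly"
  let ?rim = "Pow (Inl ` {..<?m} :: (nat + nat) set)"
  let ?ins = "\<lambda>S. insert (Inr 0) (Inl ` S) :: (nat + nat) set"
  let ?hub = "?ins ` {S. rim_visible ?m S}"
  \<comment> \<open>The rim has one vertex less than the wheel, so eight becomes the seven of
    \<open>csuc_neq\<close>.\<close>
  have n: "n \<ge> 4" and m: "7 \<le> ?m" using assms by auto
  have fin: "finite {S. rim_visible ?m S}"
    by (rule finite_subset[of _ "Pow {..<?m}"]) (auto simp: rim_visible_def)
  have "inj_on ?ins {S. rim_visible ?m S}" by (auto simp: inj_on_def)
  moreover have "card (?ins S) = Suc (card S)" if "rim_visible ?m S" for S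
  proof -
    have "finite S" using that by (auto simp: rim_visible_def intro: finite_subset)
    then show ?thesis by (subst card_insert_disjoint) (auto simp: card_image)
  qed
  ultimately have hub: "(\<Sum>X\<in>?hub. ?x ^ card X) = (\<Sum>S | rim_visible ?m S. ?x ^ Suc (card S))"
    by (simp add: sum.reindex)
  have rim: "(\<Sum>X\<in>?rim. ?x ^ card X) = (1 + ?x) ^ ?m"
    by (simp only: sum_Pow_power_card finite_imageI finite_lessThan card_image inj_Inl card_lessThan)
  have "visibility_poly (wheel_graph n) = (\<Sum>X\<in>?rim \<union> ?hub. ?x ^ card X)"
    by (simp add: visibility_poly_eq_sum pverts_wheel_graph mutual_visibility_wheel_graph[OF n])
  \<comment> \<open>Membership of \<open>Inr 0\<close> separates the two families.\<close>
  also have "\<dots> = (\<Sum>X\<in>?rim. ?x ^ card X) + (\<Sum>X\<in>?hub. ?x ^ card X)"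
    using fin by (intro sum.union_disjoint) auto
  also have "\<dots> = (1 + ?x) ^ ?m + (?x + of_nat ?m * ?x ^ 2 + of_nat (2 * ?m) * ?x ^ 3)"
    by (simp only: hub rim sum_rim_visible[OF m])
  finally show ?thesis by (simp only: add.assoc)
qed

end
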